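(* There is an absolute constant $C>0$ such that for all $\varepsilon,\delta,\beta,\psi>0$ and all $n\in\mathbb{N}$, $n\ge1$, there exists an $(\varepsilon,\delta)$-differentially private (randomized) algorithm $M:\mathbb{R}^n\to\mathbb{R}$ such that for every probability distribution $P$ on $\mathbb{R}$ with $\mathbb{E}_{X\leftarrow P}[X]=\mu\in[0,1]$, $\mathbb{E}_{X\leftarrow P}[(X-\mu)^2]\le1$ and $\mathbb{E}_{X\leftarrow P}[(X-\mu)^4]\le\psi^4$, we have $$\left|\mathbb{E}_{X\leftarrow P^n,M}[M(X)-\mu]\right|\le\beta$$ and $$\mathbb{E}_{X\leftarrow P^n,M}\left[(M(X)-\mu)^2\right]\le C\left(\frac1n+\min\left\{\frac{1}{n^2\varepsilon^2\beta^2}+\beta^2,\ \ \frac{\psi^2}{n^{3/2}\,\varepsilon\,\delta^{1/2}}+\frac{1}{n^2\varepsilon^2},\ \ \frac{1}{n\,\delta}\right\}\right).$$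
   Context: A randomized algorithm $M:\mathcal{X}^n\to\mathcal{Y}$ is $(\varepsilon,\delta)$-differentially private ($(\varepsilon,\delta)$-DP), for $\varepsilon,\delta\ge0$, if for all datasets $x,x'\in\mathcal{X}^n$ differing in exactly one coordinate and all measurable $Y\subseteq\mathcal{Y}$, $\Pr[M(x)\in Y]\le e^{\varepsilon}\Pr[M(x')\in Y]+\delta$. $X\leftarrow P^n$ means $X=(X_1,\dots,X_n)$ consists of $n$ i.i.d. samples from $P$; $\mathbb{E}_{X\leftarrow P^n,M}$ is the expectation over both $X$ and the independent internal randomness of $M$. *)

theory Defs
  imports "HOL-Probability.Probability"
begin

(* Datasets in X^n are the points of the n-fold product space, i.e. functions on {..<n}
   that are undefined elsewhere.  A randomized algorithm is a Markov kernel: M x is the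
   distribution of the output on the dataset x. *)
definition randomized_algorithm ::
  "nat \<Rightarrow> 'a measure \<Rightarrow> 'b measure \<Rightarrow> ((nat \<Rightarrow> 'a) \<Rightarrow> 'b measure) \<Rightarrow> bool" where
  "randomized_algorithm n X Y M \<longleftrightarrow> M \<in> PiM {..<n} (\<lambda>_. X) \<rightarrow>\<^sub>M prob_algebra Y"

definition neighbouring :: "nat \<Rightarrow> (nat \<Rightarrow> 'a) \<Rightarrow> (nat \<Rightarrow> 'a) \<Rightarrow> bool" where
  "neighbouring n x x' \<longleftrightarrow> card {i \<in> {..<n}. x i \<noteq> x' i} = 1"

definition differentially_private ::
  "nat \<Rightarrow> 'a measure \<Rightarrow> 'b measure \<Rightarrow> real \<Rightarrow> real \<Rightarrow> ((nat \<Rightarrow> 'a) \<Rightarrow> 'b measure) \<Rightarrow> bool" where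
  "differentially_private n X Y \<epsilon> \<delta> M \<longleftrightarrow>
     randomized_algorithm n X Y M \<and>
     (\<forall>x \<in> space (PiM {..<n} (\<lambda>_. X)). \<forall>x' \<in> space (PiM {..<n} (\<lambda>_. X)).
        neighbouring n x x' \<longrightarrow>
        (\<forall>S \<in> sets Y. measure (M x) S \<le> exp \<epsilon> * measure (M x') S + \<delta>))"

(* The law of M(X) for X = (X_1, ..., X_n) drawn i.i.d. from P, with the internal
   randomness of M independent of X. *)
definition output_law :: "nat \<Rightarrow> 'a measure \<Rightarrow> ((nat \<Rightarrow> 'a) \<Rightarrow> 'b measure) \<Rightarrow> 'b measure" where
  "output_law n P M = PiM {..<n} (\<lambda>_. P) \<bind> M"

end

theory Submission
  imports Defs
begin

text \<open>
  The estimator adds up, over the entries of the dataset, two contributions. The clipped entry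
  \<open>clip T x / n\<close> always takes part; it changes by at most \<open>2 * T / n\<close> when the entry is replaced,
  so that Laplace noise of scale \<open>s = 2 * T / (n * \<epsilon>)\<close> hides the change up to the factor
  \<open>exp \<epsilon>\<close>. The residual \<open>(x - clip T x) / (n * p)\<close>, which is unbounded, takes part only if a coin of
  bias \<open>p\<close> says so; the division by \<open>p\<close> makes the expected contribution of the entry exactly
  \<open>x / n\<close>. The replaced entry reveals its residual with probability at most \<open>p\<close>, and with
  \<open>p \<le> \<delta>\<close> this event is paid for by the additive slack of \<open>(\<epsilon>, \<delta>)\<close>-privacy
  (lemma \<open>differentially_private_sampled_sum\<close>).

  If \<open>p > 0\<close>, the estimator is unbiased, and by independence its variance is at most
  \<open>1 / n + (1 - p) / (n * p) * E[(X - clip T X)^2] + 8 * T^2 / (n^2 * \<epsilon>^2)\<close>.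
  Three choices of the parameters give the three bounds.

  \<^item> \<open>p = 0\<close>, \<open>T = 2 / \<beta>\<close>: the residual is dropped. The bias is at most
    \<open>E[X^2] / T \<le> 2 / T = \<beta>\<close>, and the noise costs \<open>32 / (n^2 * \<epsilon>^2 * \<beta>^2)\<close>
    (lemma \<open>accurate_biased\<close>).
  \<^item> \<open>p = \<delta>\<close>, \<open>T = 1 + t\<close>: since \<open>\<mu>\<close> lies in the unit interval, a nonzero residual means that
    \<open>X\<close> is at distance more than \<open>t\<close> from \<open>\<mu>\<close>, so the second moment of the residual is at most
    \<open>\<psi>^4 / t^2\<close>. The value \<open>t^2 = \<psi>^2 * sqrt n * \<epsilon> / sqrt \<delta>\<close> balances the sampling error
    \<open>\<psi>^4 / (n * \<delta> * t^2)\<close> against the noise \<open>t^2 / (n^2 * \<epsilon>^2)\<close>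
    (lemma \<open>accurate_tail_sampled\<close>).
  \<^item> \<open>p = \<delta>\<close>, \<open>T = 0\<close>: there is no noise, and everything is sampled
    (lemma \<open>accurate_sampled\<close>).

  The last two choices are for \<open>\<delta> < 1\<close>. For \<open>\<delta> \<ge> 1\<close> privacy is no restriction; \<open>p = 1\<close> then gives the
  empirical mean.

  The parameters \<open>\<epsilon>\<close>, \<open>\<delta>\<close>, \<open>\<beta>\<close>, \<open>\<psi>\<close> and \<open>n\<close> are known to the algorithm, so it can use the
  choice whose bound is smallest.
\<close>

section \<open>Means and variances of independent sums and mixtures\<close>

text \<open>
  A random variable has mean \<open>m\<close> and variance \<open>v\<close> if and only if its second moment about every
  point \<open>a\<close> is \<open>v + (m - a)^2\<close>. Stating this with nonnegative integrals makes integrability part of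
  the predicate, and it lets independent sums and mixtures be treated by Tonelli's theorem.
\<close>

definition mean_variance :: "'a measure \<Rightarrow> ('a \<Rightarrow> real) \<Rightarrow> real \<Rightarrow> real \<Rightarrow> bool" where
  "mean_variance M f m v \<longleftrightarrow>
     f \<in> borel_measurable M \<and> 0 \<le> v \<and>
     (\<forall>a. (\<integral>\<^sup>+x. ennreal ((f x - a)\<^sup>2) \<partial>M) = ennreal (v + (m - a)\<^sup>2))"

lemma (in prob_space) mean_varianceI:
  assumes [measurable]: "f \<in> borel_measurable M" and f: "integrable M (\<lambda>x. (f x)\<^sup>2)"
  shows "mean_variance M f (expectation f) (variance f)"
proof -
  have int: "integrable M f"
    using square_integrable_imp_integrable[OF _ f] by simp
  have "(\<integral>\<^sup>+x. ennreal ((f x - a)\<^sup>2) \<partial>M) = ennreal (variance f + (expectation f - a)\<^sup>2)" for a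
  proof -
    have i: "integrable M (\<lambda>x. (f x - a)\<^sup>2)"
      unfolding power2_diff using int f by (intro Bochner_Integration.integrable_add
        Bochner_Integration.integrable_diff) auto
    have "expectation (\<lambda>x. (f x - a)\<^sup>2) = expectation (\<lambda>x. (f x)\<^sup>2) - 2 * a * expectation f + a\<^sup>2"
      unfolding power2_diff using int f by (simp add: prob_space algebra_simps)
    also have "\<dots> = variance f + (expectation f - a)\<^sup>2"
      using int f by (simp add: variance_eq prob_space power2_eq_square algebra_simps)
    finally show ?thesis
      using i by (subst nn_integral_eq_integral) auto
  qed
  then show ?thesis
    by (simp add: mean_variance_def variance_positive)
qed

lemma (in prob_space) mean_varianceD:
  assumes "mean_variance M f m v"
  shows "integrable M f" "expectation f = m"
    "integrable M (\<lambda>x. (f x - a)\<^sup>2)" "expectation (\<lambda>x. (f x - a)\<^sup>2) = v + (m - a)\<^sup>2"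
proof -
  have [measurable]: "f \<in> borel_measurable M" and v: "0 \<le> v"
    and nn: "(\<integral>\<^sup>+x. ennreal ((f x - a)\<^sup>2) \<partial>M) = ennreal (v + (m - a)\<^sup>2)" for a
    using assms by (auto simp: mean_variance_def)
  have i: "integrable M (\<lambda>x. (f x - a)\<^sup>2)" for a
    by (intro integrableI_nonneg) (auto simp: nn)
  have e: "expectation (\<lambda>x. (f x - a)\<^sup>2) = v + (m - a)\<^sup>2" for a
    using v by (subst integral_eq_nn_integral) (auto simp: nn simp del: ennreal_plus)
  show "integrable M (\<lambda>x. (f x - a)\<^sup>2)" "expectation (\<lambda>x. (f x - a)\<^sup>2) = v + (m - a)\<^sup>2"
    by (rule i, rule e)
  show int: "integrable M f"
    using square_integrable_imp_integrable[of f] i[of 0] by simp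
  \<comment> \<open>Second moments about two points determine the mean, as in the polarisation identity.\<close>
  have "expectation (\<lambda>x. (f x - 0)\<^sup>2 - (f x - 1)\<^sup>2) = 2 * expectation f - 1"
    using int by (simp add: power2_diff prob_space)
  moreover have "expectation (\<lambda>x. (f x - 0)\<^sup>2 - (f x - 1)\<^sup>2) = (v + (m - 0)\<^sup>2) - (v + (m - 1)\<^sup>2)"
    unfolding e[symmetric] by (intro Bochner_Integration.integral_diff i)
  ultimately show "expectation f = m"
    by (simp add: power2_diff)
qed

lemma (in prob_space) mean_variance_scaleI:
  assumes "f \<in> borel_measurable M" "integrable M (\<lambda>x. (f x)\<^sup>2)"
  shows "mean_variance M (\<lambda>x. c * f x) (c * expectation f) (c\<^sup>2 * variance f)"
proof -
  have "(\<lambda>x. (c * f x - c * expectation f)\<^sup>2) = (\<lambda>x. c\<^sup>2 * (f x - expectation f)\<^sup>2)"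
    by (simp add: right_diff_distrib[symmetric] power_mult_distrib)
  with mean_varianceI[of "\<lambda>x. c * f x"] assms show ?thesis
    by (simp add: power_mult_distrib)
qed

lemma mean_variance_pair:
  assumes f: "mean_variance M f m v" and g: "mean_variance N g m' v'"
    and M: "prob_space M" and N: "prob_space N"
  shows "mean_variance (M \<Otimes>\<^sub>M N) (\<lambda>z. f (fst z) + g (snd z)) (m + m') (v + v')"
proof -
  interpret M: prob_space M by fact
  interpret N: prob_space N by fact
  have [measurable]: "f \<in> borel_measurable M" "g \<in> borel_measurable N" and v: "0 \<le> v" "0 \<le> v'"
    and nf: "(\<integral>\<^sup>+x. ennreal ((f x - a)\<^sup>2) \<partial>M) = ennreal (v + (m - a)\<^sup>2)"
    and ng: "(\<integral>\<^sup>+x. ennreal ((g x - a)\<^sup>2) \<partial>N) = ennreal (v' + (m' - a)\<^sup>2)" for a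
    using f g by (auto simp: mean_variance_def)
  have "(\<integral>\<^sup>+z. ennreal ((f (fst z) + g (snd z) - a)\<^sup>2) \<partial>(M \<Otimes>\<^sub>M N))
     = ennreal (v + v' + (m + m' - a)\<^sup>2)" for a
  proof -
    have "(\<integral>\<^sup>+z. ennreal ((f (fst z) + g (snd z) - a)\<^sup>2) \<partial>(M \<Otimes>\<^sub>M N))
       = (\<integral>\<^sup>+x. \<integral>\<^sup>+y. ennreal ((g y - (a - f x))\<^sup>2) \<partial>N \<partial>M)"
      by (subst N.nn_integral_fst[symmetric]) (auto simp: algebra_simps)
    also have "\<dots> = (\<integral>\<^sup>+x. ennreal v' + ennreal ((f x - (a - m'))\<^sup>2) \<partial>M)"
      using v unfolding ng by (simp add: ennreal_plus[symmetric] algebra_simps del: ennreal_plus)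
    also have "\<dots> = ennreal v' + ennreal (v + (m - (a - m'))\<^sup>2)"
      by (subst nn_integral_add) (auto simp: nf M.emeasure_space_1)
    also have "\<dots> = ennreal (v + v' + (m + m' - a)\<^sup>2)"
      using v by (simp add: ennreal_plus[symmetric] algebra_simps del: ennreal_plus)
    finally show ?thesis .
  qed
  with v show ?thesis by (simp add: mean_variance_def)
qed

lemma mean_variance_PiM:
  assumes I: "finite I" and M: "prob_space M"
    and f: "\<And>i. i \<in> I \<Longrightarrow> mean_variance M (f i) (m i) (v i)"
  shows "mean_variance (PiM I (\<lambda>_. M)) (\<lambda>x. \<Sum>i\<in>I. f i (x i)) (\<Sum>i\<in>I. m i) (\<Sum>i\<in>I. v i)"
  using I f
proof (induction I rule: finite_induct)
  case empty
  interpret product_prob_space "\<lambda>_. M" "{}"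
    by (intro product_prob_spaceI M)
  show ?case
    by (simp add: mean_variance_def nn_integral_const P.emeasure_space_1)
next
  case (insert i I)
  interpret product_prob_space "\<lambda>_. M" "insert i I"
    by (intro product_prob_spaceI M)
  interpret M: prob_space M by fact
  interpret P': prob_space "PiM I (\<lambda>_. M)"
    by (intro prob_space_PiM M)
  have [measurable]: "f j \<in> borel_measurable M" if "j \<in> insert i I" for j
    using insert.prems[of j] that by (auto simp: mean_variance_def)
  have pos: "0 \<le> v i" "0 \<le> (\<Sum>i\<in>I. v i)"
    and nf: "(\<integral>\<^sup>+x. ennreal ((f i x - a)\<^sup>2) \<partial>M) = ennreal (v i + (m i - a)\<^sup>2)"
    and nF: "(\<integral>\<^sup>+x. ennreal (((\<Sum>i\<in>I. f i (x i)) - a)\<^sup>2) \<partial>PiM I (\<lambda>_. M)) =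
         ennreal ((\<Sum>i\<in>I. v i) + ((\<Sum>i\<in>I. m i) - a)\<^sup>2)" for a
    using insert.prems[of i] insert.IH insert.prems by (auto simp: mean_variance_def)
  have "(\<integral>\<^sup>+x. ennreal (((\<Sum>j\<in>insert i I. f j (x j)) - a)\<^sup>2) \<partial>PiM (insert i I) (\<lambda>_. M)) =
    ennreal ((\<Sum>j\<in>insert i I. v j) + ((\<Sum>j\<in>insert i I. m j) - a)\<^sup>2)" for a
  proof -
    have "(\<integral>\<^sup>+x. ennreal (((\<Sum>j\<in>insert i I. f j (x j)) - a)\<^sup>2) \<partial>PiM (insert i I) (\<lambda>_. M))
       = (\<integral>\<^sup>+x. \<integral>\<^sup>+y. ennreal (((\<Sum>j\<in>insert i I. f j ((x(i := y)) j)) - a)\<^sup>2) \<partial>M \<partial>PiM I (\<lambda>_. M))"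
      using insert.hyps by (subst product_nn_integral_insert) auto
    also have "\<dots> = (\<integral>\<^sup>+x. \<integral>\<^sup>+y. ennreal ((f i y - (a - (\<Sum>j\<in>I. f j (x j))))\<^sup>2) \<partial>M \<partial>PiM I (\<lambda>_. M))"
    proof -
      have "(\<Sum>j\<in>insert i I. f j ((x(i := y)) j)) - a = f i y - (a - (\<Sum>j\<in>I. f j (x j)))" for x y
      proof -
        have "(\<Sum>j\<in>I. f j ((x(i := y)) j)) = (\<Sum>j\<in>I. f j (x j))"
          using insert.hyps by (intro sum.cong) auto
        then show ?thesis using insert.hyps by simp
      qed
      then show ?thesis by presburger
    qed
    also have "\<dots> = (\<integral>\<^sup>+x. ennreal (v i) + ennreal (((\<Sum>j\<in>I. f j (x j)) - (a - m i))\<^sup>2) \<partial>PiM I (\<lambda>_. M))"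
      using pos unfolding nf by (simp add: ennreal_plus[symmetric] algebra_simps del: ennreal_plus)
    also have "\<dots> = ennreal (v i) + ennreal ((\<Sum>j\<in>I. v j) + ((\<Sum>j\<in>I. m j) - (a - m i))\<^sup>2)"
      by (subst nn_integral_add) (auto simp: nF P'.emeasure_space_1)
    also have "\<dots> = ennreal ((\<Sum>j\<in>insert i I. v j) + ((\<Sum>j\<in>insert i I. m j) - a)\<^sup>2)"
      using pos insert.hyps by (simp add: ennreal_plus[symmetric] algebra_simps del: ennreal_plus)
    finally show ?thesis .
  qed
  moreover have "0 \<le> (\<Sum>j\<in>insert i I. v j)"
    using pos insert.hyps by simp
  ultimately show ?case
    unfolding mean_variance_def by simp
qed

text \<open>
  The law of total variance: the variance of a mixture is the variance of the conditional mean plus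
  the mean of the conditional variance. In the moments about \<open>a\<close> this is the identity
  \<open>E[v x + (m x - a)^2] = E[v x] + w + (\<mu> - a)^2\<close>.
\<close>

lemma mean_variance_bind:
  assumes L: "prob_space L" and K: "K \<in> L \<rightarrow>\<^sub>M prob_algebra borel"
    and Kx: "\<And>x. x \<in> space L \<Longrightarrow> mean_variance (K x) (\<lambda>y. y) (m x) (v x)"
    and m: "mean_variance L m \<mu> w"
    and v: "integrable L v"
  shows "mean_variance (L \<bind> K) (\<lambda>y. y) \<mu> (w + (\<integral>x. v x \<partial>L))"
proof -
  interpret L: prob_space L by fact
  have [measurable]: "m \<in> borel_measurable L" and w: "0 \<le> w"
    and nm: "(\<integral>\<^sup>+x. ennreal ((m x - a)\<^sup>2) \<partial>L) = ennreal (w + (\<mu> - a)\<^sup>2)" for a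
    using m by (auto simp: mean_variance_def)
  have [measurable]: "v \<in> borel_measurable L" using v by simp
  have Kpos: "0 \<le> v x"
    and nK: "(\<integral>\<^sup>+y. ennreal ((y - a)\<^sup>2) \<partial>K x) = ennreal (v x + (m x - a)\<^sup>2)" if "x \<in> space L" for x a
    using Kx[OF that] by (auto simp: mean_variance_def)
  have vpos: "0 \<le> (\<integral>x. v x \<partial>L)"
    using Kpos by (intro integral_nonneg_AE) auto
  have "(\<integral>\<^sup>+y. ennreal ((y - a)\<^sup>2) \<partial>(L \<bind> K)) = ennreal (w + (\<integral>x. v x \<partial>L) + (\<mu> - a)\<^sup>2)" for a
  proof -
    have "(\<integral>\<^sup>+y. ennreal ((y - a)\<^sup>2) \<partial>(L \<bind> K)) = (\<integral>\<^sup>+x. \<integral>\<^sup>+y. ennreal ((y - a)\<^sup>2) \<partial>K x \<partial>L)"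
      by (rule nn_integral_bind[OF _ measurable_prob_algebraD[OF K]]) simp
    also have "\<dots> = (\<integral>\<^sup>+x. ennreal (v x) + ennreal ((m x - a)\<^sup>2) \<partial>L)"
      by (intro nn_integral_cong) (simp add: nK Kpos)
    also have "\<dots> = (\<integral>\<^sup>+x. ennreal (v x) \<partial>L) + ennreal (w + (\<mu> - a)\<^sup>2)"
      by (subst nn_integral_add) (auto simp: nm)
    also have "(\<integral>\<^sup>+x. ennreal (v x) \<partial>L) = ennreal (\<integral>x. v x \<partial>L)"
      using v Kpos by (intro nn_integral_eq_integral) auto
    finally show ?thesis
      using vpos w by (simp add: ennreal_plus[symmetric] algebra_simps del: ennreal_plus)
  qed
  moreover have "(\<lambda>y. y) \<in> borel_measurable (L \<bind> K)"
    using sets_bind[OF sets_kernel[OF measurable_prob_algebraD[OF K]] L.not_empty]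
    by (simp cong: measurable_cong_sets)
  ultimately show ?thesis
    using vpos w by (simp add: mean_variance_def)
qed

section \<open>Laplace noise\<close>

definition laplace :: "real measure" where
  "laplace = density lborel (\<lambda>z. ennreal (exp (- \<bar>z\<bar>) / 2))"

lemma sets_laplace[measurable_cong]: "sets laplace = sets borel"
  by (simp add: laplace_def)

text \<open>
  Folding the density at the origin reduces its moments to the Gamma integrals
  \<open>\<integral> x^k * exp (- x) = k!\<close>; odd moments cancel.
\<close>

lemma laplace_moments:
  shows prob_space_laplace: "prob_space laplace"
    and mean_variance_laplace: "mean_variance laplace (\<lambda>z. s * z) 0 (2 * s\<^sup>2)"
proof -
  have half: "has_bochner_integral lborel
      (\<lambda>x::real. indicator {0..} x *\<^sub>R (exp (- \<bar>x\<bar>) * x ^ k)) (fact k)" for k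
  proof (rule has_bochner_integral_nn_integral)
    have "(\<integral>\<^sup>+x. ennreal (indicator {0..} x *\<^sub>R (exp (- \<bar>x\<bar>) * x ^ k)) \<partial>lborel)
       = (\<integral>\<^sup>+x. ennreal (x ^ k * exp (- x)) * indicator {0..} x \<partial>lborel)"
      by (intro nn_integral_cong) (auto simp: indicator_def mult.commute)
    also have "\<dots> = ennreal (fact k)"
      unfolding nn_intergal_power_times_exp_Ici ennreal_of_nat_eq_real_of_nat by simp
    finally show "(\<integral>\<^sup>+x. ennreal (indicator {0..} x *\<^sub>R (exp (- \<bar>x\<bar>) * x ^ k)) \<partial>lborel)
      = ennreal (fact k)" .
  qed (auto simp: indicator_def)
  have even: "has_bochner_integral lborel (\<lambda>x::real. exp (- \<bar>x\<bar>) / 2 * x ^ k) (fact k)"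
    if "even k" for k
    using has_bochner_integral_divide[OF has_bochner_integral_even_function[OF half[of k]], of 2] that
    by simp
  have odd: "has_bochner_integral lborel (\<lambda>x::real. exp (- \<bar>x\<bar>) / 2 * x ^ k) 0"
    if "odd k" for k
    using has_bochner_integral_divide[OF has_bochner_integral_odd_function[OF half[of k]], of 2] that
    by simp
  have "emeasure laplace (space laplace) = (\<integral>\<^sup>+x. ennreal (exp (- \<bar>x\<bar>) / 2) \<partial>lborel)"
    by (simp add: laplace_def emeasure_density)
  also have "\<dots> = 1"
    using has_bochner_integral_iff[THEN iffD1, OF even[of 0]] by (subst nn_integral_eq_integral) auto
  finally show lap: "prob_space laplace" by (rule prob_spaceI)
  then interpret prob_space laplace .
  have d: "has_bochner_integral laplace f c"
    if "has_bochner_integral lborel (\<lambda>x. exp (- \<bar>x\<bar>) / 2 * f x) c" "f \<in> borel_measurable borel" for f c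
    using that unfolding has_bochner_integral_iff laplace_def
    by (simp add: integrable_density integral_density)
  have 1: "has_bochner_integral laplace (\<lambda>z. z) 0"
    using odd[of 1] by (intro d) auto
  have 2: "has_bochner_integral laplace (\<lambda>z. z\<^sup>2) 2"
    using even[of 2] by (intro d) auto
  have "mean_variance laplace (\<lambda>z. s * z) (expectation (\<lambda>z. s * z)) (variance (\<lambda>z. s * z))"
    using 2 by (intro mean_varianceI) (auto simp: power_mult_distrib has_bochner_integral_iff)
  then show "mean_variance laplace (\<lambda>z. s * z) 0 (2 * s\<^sup>2)"
    using 1 2 by (simp add: power_mult_distrib has_bochner_integral_iff mult.commute)
qed

text \<open>
  Moving the centre from \<open>c\<close> to \<open>c'\<close> shifts the standard density by \<open>(c' - c) / s\<close>, and shifting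
  \<open>exp (- \<bar>z\<bar>)\<close> by at most \<open>\<epsilon>\<close> changes it by a factor of at most \<open>exp \<epsilon>\<close>. The degenerate scale
  \<open>s = 0\<close> is included, because the estimator that does not clip uses no noise.
\<close>

lemma laplace_shift:
  assumes [measurable]: "S \<in> sets borel" and \<epsilon>: "0 \<le> \<epsilon>" and s: "0 \<le> s" and c: "\<bar>c - c'\<bar> \<le> \<epsilon> * s"
  shows "(\<integral>\<^sup>+z. indicator S (c + s * z) \<partial>laplace)
    \<le> ennreal (exp \<epsilon>) * (\<integral>\<^sup>+z. indicator S (c' + s * z) \<partial>laplace)"
proof (cases "s = 0")
  case True
  with c have "c = c'" by simp
  have "1 * (\<integral>\<^sup>+z. indicator S (c + s * z) \<partial>laplace)
    \<le> ennreal (exp \<epsilon>) * (\<integral>\<^sup>+z. indicator S (c + s * z) \<partial>laplace)"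
    using \<epsilon> by (intro mult_right_mono) (auto simp: ennreal_1[symmetric] simp del: ennreal_1)
  with \<open>c = c'\<close> show ?thesis by simp
next
  case False
  with s have s: "0 < s" by simp
  define t where "t = (c' - c) / s"
  have t: "\<bar>t\<bar> \<le> \<epsilon>"
    using c s by (simp add: t_def abs_minus_commute divide_le_eq)
  have "(\<integral>\<^sup>+z. indicator S (c + s * z) \<partial>laplace)
     = (\<integral>\<^sup>+z. ennreal (exp (- \<bar>z\<bar>) / 2) * indicator S (c + s * z) \<partial>lborel)"
    unfolding laplace_def by (subst nn_integral_density) auto
  also have "\<dots> = (\<integral>\<^sup>+z. ennreal (exp (- \<bar>t + z\<bar>) / 2) * indicator S (c + s * (t + z)) \<partial>lborel)"
    by (subst nn_integral_real_affine[where c = 1 and t = t]) auto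
  also have "\<dots> = (\<integral>\<^sup>+z. ennreal (exp (- \<bar>t + z\<bar>) / 2) * indicator S (c' + s * z) \<partial>lborel)"
    using s by (simp add: t_def distrib_left)
  also have "\<dots> \<le> (\<integral>\<^sup>+z. ennreal (exp \<epsilon>) * (ennreal (exp (- \<bar>z\<bar>) / 2) * indicator S (c' + s * z)) \<partial>lborel)"
  proof (rule nn_integral_mono)
    fix z :: real
    have "exp (- \<bar>t + z\<bar>) \<le> exp \<epsilon> * exp (- \<bar>z\<bar>)"
      using t unfolding exp_add[symmetric] exp_le_cancel_iff by linarith
    then show "ennreal (exp (- \<bar>t + z\<bar>) / 2) * indicator S (c' + s * z)
      \<le> ennreal (exp \<epsilon>) * (ennreal (exp (- \<bar>z\<bar>) / 2) * indicator S (c' + s * z))"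
      by (auto simp: indicator_def ennreal_mult'[symmetric])
  qed
  also have "\<dots> = ennreal (exp \<epsilon>) * (\<integral>\<^sup>+z. indicator S (c' + s * z) \<partial>laplace)"
    unfolding laplace_def by (simp add: nn_integral_density nn_integral_cmult)
  finally show ?thesis .
qed


section \<open>Sums with sampled summands and Laplace noise\<close>

lemma mean_variance_bernoulli:
  assumes "0 \<le> p" "p \<le> 1"
  shows "mean_variance (measure_pmf (bernoulli_pmf p)) (\<lambda>b. of_bool b * h) (p * h) (p * (1 - p) * h\<^sup>2)"
proof -
  have "(\<integral>\<^sup>+b. ennreal ((of_bool b * h - a)\<^sup>2) \<partial>measure_pmf (bernoulli_pmf p))
      = ennreal (p * (1 - p) * h\<^sup>2 + (p * h - a)\<^sup>2)" for a
  proof -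
    have "(\<integral>\<^sup>+b. ennreal ((of_bool b * h - a)\<^sup>2) \<partial>measure_pmf (bernoulli_pmf p))
        = ennreal ((h - a)\<^sup>2) * ennreal p + ennreal (a\<^sup>2) * ennreal (1 - p)"
      using assms by simp
    also have "\<dots> = ennreal (p * (1 - p) * h\<^sup>2 + (p * h - a)\<^sup>2)"
      using assms by (simp add: ennreal_mult'[symmetric] ennreal_plus[symmetric] del: ennreal_plus)
        (simp add: power2_eq_square algebra_simps)
    finally show ?thesis .
  qed
  with assms show ?thesis by (simp add: mean_variance_def)
qed

definition coins_and_noise :: "nat \<Rightarrow> real \<Rightarrow> ((nat \<Rightarrow> bool) \<times> real) measure" where
  "coins_and_noise n p = PiM {..<n} (\<lambda>_. measure_pmf (bernoulli_pmf p)) \<Otimes>\<^sub>M laplace"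

definition sampled_sum ::
  "nat \<Rightarrow> real \<Rightarrow> real \<Rightarrow> (real \<Rightarrow> real) \<Rightarrow> (real \<Rightarrow> real) \<Rightarrow> (nat \<Rightarrow> real) \<Rightarrow> real measure" where
  "sampled_sum n p s g h x = distr (coins_and_noise n p) borel
     (\<lambda>(b, z). (\<Sum>i<n. g (x i)) + (\<Sum>i<n. of_bool (b i) * h (x i)) + s * z)"

lemma prob_space_coins: "prob_space (PiM {..<n} (\<lambda>_. measure_pmf (bernoulli_pmf p)))"
  by (intro prob_space_PiM prob_space_measure_pmf)

lemma prob_space_coins_and_noise: "prob_space (coins_and_noise n p)"
proof -
  interpret pair_prob_space "PiM {..<n} (\<lambda>_. measure_pmf (bernoulli_pmf p))" laplace
    unfolding pair_prob_space_def pair_sigma_finite_def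
    by (intro conjI prob_space_imp_sigma_finite prob_space_coins prob_space_laplace)
  show ?thesis unfolding coins_and_noise_def by unfold_locales
qed

lemma measurable_coin[measurable]:
  "i < n \<Longrightarrow> (\<lambda>b. of_bool (b i) :: real) \<in> borel_measurable (PiM {..<n} (\<lambda>_. measure_pmf (bernoulli_pmf p)))"
  by (rule measurable_compose[OF measurable_component_singleton[of i "{..<n}"]]) auto

lemma measurable_sampled_sum:
  assumes [measurable]: "g \<in> borel_measurable borel" "h \<in> borel_measurable borel"
  shows "sampled_sum n p s g h \<in> PiM {..<n} (\<lambda>_. borel) \<rightarrow>\<^sub>M prob_algebra borel"
proof (rule measurable_prob_algebraI)
  interpret R: prob_space "coins_and_noise n p" by (rule prob_space_coins_and_noise)
  have F: "(\<lambda>(x, b, z). (\<Sum>i<n. g (x i)) + (\<Sum>i<n. of_bool (b i) * h (x i)) + s * z)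
      \<in> borel_measurable (PiM {..<n} (\<lambda>_. borel) \<Otimes>\<^sub>M coins_and_noise n p)"
    unfolding coins_and_noise_def by measurable
  have "(\<lambda>(b, z). (\<Sum>i<n. g (x i)) + (\<Sum>i<n. of_bool (b i) * h (x i)) + s * z)
      \<in> borel_measurable (coins_and_noise n p)" for x
    unfolding coins_and_noise_def by measurable
  then show "prob_space (sampled_sum n p s g h x)" for x
    unfolding sampled_sum_def by (intro R.prob_space_distr)
  show "sampled_sum n p s g h \<in> PiM {..<n} (\<lambda>_. borel) \<rightarrow>\<^sub>M subprob_algebra borel"
    unfolding sampled_sum_def[abs_def] using F
    by (intro measurable_distr2[where M = "coins_and_noise n p"])
       (auto simp: space_subprob_algebra R.subprob_space_axioms)
qed

lemma emeasure_sampled_sum: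
  assumes [measurable]: "S \<in> sets borel"
  shows "emeasure (sampled_sum n p s g h x) S =
    (\<integral>\<^sup>+b. \<integral>\<^sup>+z. indicator S ((\<Sum>i<n. g (x i)) + (\<Sum>i<n. of_bool (b i) * h (x i)) + s * z) \<partial>laplace
      \<partial>PiM {..<n} (\<lambda>_. measure_pmf (bernoulli_pmf p)))"
proof -
  interpret laplace: prob_space laplace by (rule prob_space_laplace)
  have "emeasure (sampled_sum n p s g h x) S = (\<integral>\<^sup>+y. indicator S y \<partial>sampled_sum n p s g h x)"
    by (simp add: sampled_sum_def)
  also have "\<dots> = (\<integral>\<^sup>+r. (\<lambda>(b, z). indicator S
      ((\<Sum>i<n. g (x i)) + (\<Sum>i<n. of_bool (b i) * h (x i)) + s * z)) r \<partial>coins_and_noise n p)"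
    unfolding sampled_sum_def coins_and_noise_def
    by (subst nn_integral_distr) (auto simp: case_prod_beta' simp del: sum_of_bool_mult_eq)
  also have "\<dots> = (\<integral>\<^sup>+b. \<integral>\<^sup>+z. indicator S
      ((\<Sum>i<n. g (x i)) + (\<Sum>i<n. of_bool (b i) * h (x i)) + s * z) \<partial>laplace
      \<partial>PiM {..<n} (\<lambda>_. measure_pmf (bernoulli_pmf p)))"
    unfolding coins_and_noise_def by (subst laplace.nn_integral_fst[symmetric]) (auto simp del: sum_of_bool_mult_eq)
  finally show ?thesis .
qed

text \<open>
  Condition on the coins. If the coin of the replaced entry shows tails, the outputs on the two
  datasets differ only in the centre of the Laplace noise, by at most \<open>\<epsilon> * s\<close>. If it shows
  heads, nothing is known about the output, but this has probability \<open>p \<le> \<delta>\<close>. Both cases are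
  covered by the pointwise bound \<open>\<phi> x b \<le> exp \<epsilon> * \<phi> x' b + of_bool (b k)\<close> for the conditional
  probability \<open>\<phi>\<close> of the event; averaging over the coins gives the claim.
\<close>

lemma differentially_private_sampled_sum:
  assumes [measurable]: "g \<in> borel_measurable borel" "h \<in> borel_measurable borel"
    and p: "0 \<le> p" "p \<le> 1" "p \<le> \<delta>" and s: "0 \<le> s" and \<epsilon>: "0 \<le> \<epsilon>"
    and g: "\<And>x y. \<bar>g x - g y\<bar> \<le> \<epsilon> * s"
  shows "differentially_private n borel borel \<epsilon> \<delta> (sampled_sum n p s g h)"
  unfolding differentially_private_def randomized_algorithm_def
proof (intro conjI ballI impI)
  show "sampled_sum n p s g h \<in> PiM {..<n} (\<lambda>_. borel) \<rightarrow>\<^sub>M prob_algebra borel"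
    by (rule measurable_sampled_sum) fact+
next
  fix x x' :: "nat \<Rightarrow> real" and S :: "real set"
  assume xs: "x \<in> space (PiM {..<n} (\<lambda>_. borel))" "x' \<in> space (PiM {..<n} (\<lambda>_. borel))"
    and nb: "neighbouring n x x'" and S[measurable]: "S \<in> sets borel"
  let ?B = "PiM {..<n} (\<lambda>_. measure_pmf (bernoulli_pmf p))"
  interpret laplace: prob_space laplace by (rule prob_space_laplace)
  define c where "c y b = (\<Sum>i<n. g (y i)) + (\<Sum>i<n. of_bool (b i) * h (y i))" for y b
  have c[measurable]: "c y \<in> borel_measurable ?B" for y
    unfolding c_def by measurable
  have "card {i \<in> {..<n}. x i \<noteq> x' i} = 1"
    using nb by (simp add: neighbouring_def)
  then obtain k where k: "{i \<in> {..<n}. x i \<noteq> x' i} = {k}"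
    by (rule card_1_singletonE)
  then have eq: "x i = x' i" if "i < n" "i \<noteq> k" for i
    using that by blast
  from k have kn: "k < n" by blast
  define \<phi> where "\<phi> y b = (\<integral>\<^sup>+z. indicator S (c y b + s * z) \<partial>laplace)" for y b
  have \<phi>[measurable]: "\<phi> y \<in> borel_measurable ?B" for y
    unfolding \<phi>_def by measurable
  have "\<phi> x b \<le> ennreal (exp \<epsilon>) * \<phi> x' b + ennreal (of_bool (b k))" for b
  proof (cases "b k")
    case True
    have "\<phi> x b \<le> (\<integral>\<^sup>+z. 1 \<partial>laplace)"
      unfolding \<phi>_def by (intro nn_integral_mono) (auto simp: indicator_def)
    also have "\<dots> = 1" by (simp add: laplace.emeasure_space_1)
    finally show ?thesis using True by (simp add: add_increasing)
  next
    case False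
    have "of_bool (b i) * h (x i) = of_bool (b i) * h (x' i)" if "i < n" for i
      using False eq[OF that] by (cases "i = k") auto
    then have "(\<Sum>i<n. of_bool (b i) * h (x i)) = (\<Sum>i<n. of_bool (b i) * h (x' i))"
      by (intro sum.cong) auto
    moreover have "(\<Sum>i<n. g (x i)) - (\<Sum>i<n. g (x' i)) = g (x k) - g (x' k)"
    proof -
      have "(\<Sum>i\<in>{..<n} - {k}. g (x i)) = (\<Sum>i\<in>{..<n} - {k}. g (x' i))"
        using eq by (intro sum.cong) auto
      then show ?thesis
        using kn by (simp add: sum.remove[of "{..<n}" k])
    qed
    ultimately have "\<bar>c x b - c x' b\<bar> \<le> \<epsilon> * s"
      using g[of "x k" "x' k"] by (simp add: c_def)
    from laplace_shift[OF S \<epsilon> s this] show ?thesis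
      using False by (simp add: \<phi>_def)
  qed
  then have "(\<integral>\<^sup>+b. \<phi> x b \<partial>?B) \<le> (\<integral>\<^sup>+b. ennreal (exp \<epsilon>) * \<phi> x' b + ennreal (of_bool (b k)) \<partial>?B)"
    by (intro nn_integral_mono)
  also have "\<dots> = ennreal (exp \<epsilon>) * (\<integral>\<^sup>+b. \<phi> x' b \<partial>?B) + (\<integral>\<^sup>+b. ennreal (of_bool (b k)) \<partial>?B)"
    using kn by (simp add: nn_integral_add nn_integral_cmult)
  also have "(\<integral>\<^sup>+b. ennreal (of_bool (b k)) \<partial>?B) = (\<integral>\<^sup>+b. ennreal (of_bool b) \<partial>bernoulli_pmf p)"
    using kn distr_PiM_component[of "{..<n}" "\<lambda>_. measure_pmf (bernoulli_pmf p)" k]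
      nn_integral_distr[of "\<lambda>b. b k" ?B "measure_pmf (bernoulli_pmf p)" "\<lambda>b. ennreal (of_bool b)"]
    by (simp add: prob_space_measure_pmf measurable_component_singleton)
  also have "\<dots> = ennreal p" using p by simp
  finally have *: "emeasure (sampled_sum n p s g h x) S
    \<le> ennreal (exp \<epsilon>) * emeasure (sampled_sum n p s g h x') S + ennreal p"
    by (simp add: emeasure_sampled_sum \<phi>_def c_def)
  have prob: "prob_space (sampled_sum n p s g h y)" if "y \<in> space (PiM {..<n} (\<lambda>_. borel))" for y
    using measurable_space[OF measurable_sampled_sum that, of g h p s] by (simp add: space_prob_algebra)
  interpret X: prob_space "sampled_sum n p s g h x" using xs by (intro prob)
  interpret X': prob_space "sampled_sum n p s g h x'" using xs by (intro prob)
  have "measure (sampled_sum n p s g h x) S \<le> exp \<epsilon> * measure (sampled_sum n p s g h x') S + p"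
    using * p unfolding X.emeasure_eq_measure X'.emeasure_eq_measure
    by (simp add: ennreal_mult'[symmetric] ennreal_plus[symmetric] ennreal_le_iff del: ennreal_plus)
  then show "measure (sampled_sum n p s g h x) S \<le> exp \<epsilon> * measure (sampled_sum n p s g h x') S + \<delta>"
    using p by simp
qed

lemma mean_variance_sampled_sum:
  assumes p: "0 \<le> p" "p \<le> 1"
  shows "mean_variance (sampled_sum n p s g h x) (\<lambda>y. y)
    (\<Sum>i<n. g (x i) + p * h (x i)) ((\<Sum>i<n. p * (1 - p) * (h (x i))\<^sup>2) + 2 * s\<^sup>2)"
proof -
  let ?B = "PiM {..<n} (\<lambda>_. measure_pmf (bernoulli_pmf p))"
  have "mean_variance ?B (\<lambda>b. \<Sum>i<n. of_bool (b i) * h (x i))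
      (\<Sum>i<n. p * h (x i)) (\<Sum>i<n. p * (1 - p) * (h (x i))\<^sup>2)"
    by (intro mean_variance_PiM mean_variance_bernoulli prob_space_measure_pmf p) simp
  from mean_variance_pair[OF this mean_variance_laplace prob_space_coins prob_space_laplace, of s]
  have mv: "mean_variance (coins_and_noise n p) (\<lambda>r. (\<Sum>i<n. of_bool (fst r i) * h (x i)) + s * snd r)
      (\<Sum>i<n. p * h (x i)) ((\<Sum>i<n. p * (1 - p) * (h (x i))\<^sup>2) + 2 * s\<^sup>2)"
    by (simp add: coins_and_noise_def)
  let ?F = "\<lambda>(b, z). (\<Sum>i<n. g (x i)) + (\<Sum>i<n. of_bool (b i) * h (x i)) + s * z"
  have [measurable]: "?F \<in> borel_measurable (coins_and_noise n p)"
    unfolding coins_and_noise_def by measurable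
  have "(\<integral>\<^sup>+y. ennreal ((y - a)\<^sup>2) \<partial>sampled_sum n p s g h x) =
    ennreal ((\<Sum>i<n. p * (1 - p) * (h (x i))\<^sup>2) + 2 * s\<^sup>2 + ((\<Sum>i<n. g (x i) + p * h (x i)) - a)\<^sup>2)" for a
  proof -
    have "(\<integral>\<^sup>+y. ennreal ((y - a)\<^sup>2) \<partial>sampled_sum n p s g h x) =
      (\<integral>\<^sup>+r. ennreal ((?F r - a)\<^sup>2) \<partial>coins_and_noise n p)"
      unfolding sampled_sum_def by (subst nn_integral_distr) (auto simp del: sum_of_bool_mult_eq)
    also have "\<dots> = (\<integral>\<^sup>+r. ennreal (((\<Sum>i<n. of_bool (fst r i) * h (x i)) + s * snd r
        - (a - (\<Sum>i<n. g (x i))))\<^sup>2) \<partial>coins_and_noise n p)"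
      by (simp add: case_prod_beta algebra_simps)
    also have "\<dots> = ennreal ((\<Sum>i<n. p * (1 - p) * (h (x i))\<^sup>2) + 2 * s\<^sup>2
        + ((\<Sum>i<n. p * h (x i)) - (a - (\<Sum>i<n. g (x i))))\<^sup>2)"
      using mv unfolding mean_variance_def by blast
    also have "(\<Sum>i<n. p * h (x i)) - (a - (\<Sum>i<n. g (x i))) = (\<Sum>i<n. g (x i) + p * h (x i)) - a"
      by (simp add: sum.distrib)
    finally show ?thesis .
  qed
  moreover have "(\<lambda>y. y) \<in> borel_measurable (sampled_sum n p s g h x)"
    by (simp add: sampled_sum_def)
  ultimately show ?thesis
    using mv by (simp add: mean_variance_def)
qed

text \<open>
  Given the data, the conditional mean is a sum of i.i.d. terms \<open>g + p * h\<close>, and the conditional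
  variance comes from the coins and the noise; the law of total variance adds the two.
\<close>

lemma mean_variance_output_law_sampled_sum:
  assumes P: "prob_space P" "sets P = sets borel"
    and p: "0 \<le> p" "p \<le> 1"
    and [measurable]: "g \<in> borel_measurable borel" "h \<in> borel_measurable borel"
    and u: "mean_variance P (\<lambda>x. g x + p * h x) m v"
    and h: "integrable P (\<lambda>x. (h x)\<^sup>2)"
  shows "mean_variance (output_law n P (sampled_sum n p s g h)) (\<lambda>y. y)
    (n * m) (n * v + n * (p * (1 - p) * (\<integral>x. (h x)\<^sup>2 \<partial>P)) + 2 * s\<^sup>2)"
proof -
  interpret P: prob_space P by fact
  let ?L = "PiM {..<n} (\<lambda>_. P)"
  have L: "prob_space ?L" by (intro prob_space_PiM P)
  interpret L: prob_space ?L by (rule L)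
  have "sets ?L = sets (PiM {..<n} (\<lambda>_. borel))"
    by (intro sets_PiM_cong) (auto simp: P)
  then have K: "sampled_sum n p s g h \<in> ?L \<rightarrow>\<^sub>M prob_algebra borel"
    using measurable_sampled_sum[of g h n p s] by (simp cong: measurable_cong_sets)
  have M: "mean_variance ?L (\<lambda>x. \<Sum>i<n. g (x i) + p * h (x i)) (\<Sum>i<n. m) (\<Sum>i<n. v)"
    by (intro mean_variance_PiM P u) simp
  have comp: "integrable ?L (\<lambda>x. (h (x i))\<^sup>2)" "(\<integral>x. (h (x i))\<^sup>2 \<partial>?L) = (\<integral>x. (h x)\<^sup>2 \<partial>P)"
    if "i < n" for i
  proof -
    have d: "distr ?L P (\<lambda>x. x i) = P"
      using that by (intro distr_PiM_component P) auto
    have [measurable]: "h \<in> borel_measurable P"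
      using P by (simp cong: measurable_cong_sets)
    have [measurable]: "(\<lambda>x. x i) \<in> ?L \<rightarrow>\<^sub>M P"
      using that by (intro measurable_component_singleton) auto
    have "integrable (distr ?L P (\<lambda>x. x i)) (\<lambda>x. (h x)\<^sup>2)"
      using h by (simp add: d)
    then show "integrable ?L (\<lambda>x. (h (x i))\<^sup>2)"
      by (subst (asm) integrable_distr_eq) auto
    have "(\<integral>x. (h x)\<^sup>2 \<partial>distr ?L P (\<lambda>x. x i)) = (\<integral>x. (h (x i))\<^sup>2 \<partial>?L)"
      by (rule integral_distr) auto
    then show "(\<integral>x. (h (x i))\<^sup>2 \<partial>?L) = (\<integral>x. (h x)\<^sup>2 \<partial>P)"
      by (simp add: d)
  qed
  have V: "integrable ?L (\<lambda>x. (\<Sum>i<n. p * (1 - p) * (h (x i))\<^sup>2) + 2 * s\<^sup>2)"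
    using comp by (intro Bochner_Integration.integrable_add Bochner_Integration.integrable_sum) auto
  have "(\<integral>x. (\<Sum>i<n. p * (1 - p) * (h (x i))\<^sup>2) + 2 * s\<^sup>2 \<partial>?L)
      = n * (p * (1 - p) * (\<integral>x. (h x)\<^sup>2 \<partial>P)) + 2 * s\<^sup>2"
    using comp by (subst Bochner_Integration.integral_add)
      (auto simp: Bochner_Integration.integral_sum L.prob_space)
  with mean_variance_bind[OF L K mean_variance_sampled_sum[OF p] M V] show ?thesis
    by (simp add: output_law_def add.assoc)
qed


section \<open>Clipping\<close>

definition clip :: "real \<Rightarrow> real \<Rightarrow> real" where
  "clip T x = max (- T) (min x T)"

lemma clip_0[simp]: "clip 0 x = 0"
  by (simp add: clip_def)

lemma measurable_clip[measurable]: "clip T \<in> borel_measurable borel"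
  unfolding clip_def[abs_def] by measurable

lemma abs_clip_le: "\<bar>clip T x\<bar> \<le> \<bar>T\<bar>"
  by (auto simp: clip_def)

lemma clip_contraction: "\<bar>clip T x - clip T y\<bar> \<le> \<bar>x - y\<bar>"
  by (auto simp: clip_def max_def min_def)

lemma clip_residual_le:
  assumes "0 < T"
  shows "\<bar>x - clip T x\<bar> \<le> x\<^sup>2 / T"
proof (cases "\<bar>x\<bar> \<le> T")
  case True
  then have "x - clip T x = 0" by (auto simp: clip_def)
  then show ?thesis using assms by simp
next
  case False
  have "\<bar>x - clip T x\<bar> \<le> \<bar>x\<bar>" using assms by (auto simp: clip_def)
  also have "\<bar>x\<bar> * T \<le> \<bar>x\<bar> * \<bar>x\<bar>" using False by (intro mult_left_mono) auto
  then have "\<bar>x\<bar> \<le> x\<^sup>2 / T" using assms by (simp add: field_simps power2_eq_square)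
  finally show ?thesis .
qed

text \<open>
  If clipping at \<open>1 + t\<close> changes \<open>x\<close>, then \<open>t \<le> \<bar>x - \<mu>\<bar>\<close> because \<open>\<bar>\<mu>\<bar> \<le> 1\<close>, so that a further factor
  \<open>(x - \<mu>)^2 / t^2 \<ge> 1\<close> can be inserted. This is how the fourth moment enters.
\<close>

lemma clip_residual_square_le:
  assumes "0 < t" "\<bar>\<mu>\<bar> \<le> 1"
  shows "(x - clip (1 + t) x)\<^sup>2 \<le> (x - \<mu>) ^ 4 / t\<^sup>2"
proof (cases "\<bar>x\<bar> \<le> 1 + t")
  case True
  then have "x - clip (1 + t) x = 0" by (auto simp: clip_def)
  then show ?thesis by simp
next
  case False
  then have t: "t \<le> \<bar>x - \<mu>\<bar>" and "\<bar>x - clip (1 + t) x\<bar> \<le> \<bar>x - \<mu>\<bar>"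
    using assms by (auto simp: clip_def)
  then have "(x - clip (1 + t) x)\<^sup>2 \<le> (x - \<mu>)\<^sup>2"
    by (simp add: abs_le_square_iff)
  also have "t\<^sup>2 \<le> (x - \<mu>)\<^sup>2"
    using t assms by (simp add: abs_le_square_iff[symmetric])
  then have "(x - \<mu>)\<^sup>2 * t\<^sup>2 \<le> (x - \<mu>)\<^sup>2 * (x - \<mu>)\<^sup>2"
    by (rule mult_left_mono) simp
  then have "(x - \<mu>)\<^sup>2 \<le> (x - \<mu>) ^ 4 / t\<^sup>2"
    using assms by (simp add: field_simps power_add[symmetric])
  finally show ?thesis .
qed

section \<open>The clipped mean with a sampled residual\<close>

text \<open>
  For \<open>p = 0\<close> the residual is \<open>(x - clip T x) / 0 = 0\<close>, so this value of \<open>p\<close> gives the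
  clipped mean without a correction.
\<close>

definition clipped_mean :: "nat \<Rightarrow> real \<Rightarrow> real \<Rightarrow> real \<Rightarrow> (nat \<Rightarrow> real) \<Rightarrow> real measure" where
  "clipped_mean n \<epsilon> T p = sampled_sum n p (2 * T / (n * \<epsilon>))
     (\<lambda>x. clip T x / n) (\<lambda>x. (x - clip T x) / (n * p))"

lemma differentially_private_clipped_mean:
  assumes "n \<ge> 1" "0 < \<epsilon>" "0 \<le> T" "0 \<le> p" "p \<le> 1" "p \<le> \<delta>"
  shows "differentially_private n borel borel \<epsilon> \<delta> (clipped_mean n \<epsilon> T p)"
  unfolding clipped_mean_def
proof (rule differentially_private_sampled_sum)
  fix x y
  have "\<bar>clip T x - clip T y\<bar> \<le> 2 * T"
    using abs_clip_le[of T x] abs_clip_le[of T y] assms by linarith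
  then have "\<bar>clip T x - clip T y\<bar> / n \<le> 2 * T / n"
    by (intro divide_right_mono) auto
  then show "\<bar>clip T x / n - clip T y / n\<bar> \<le> \<epsilon> * (2 * T / (n * \<epsilon>))"
    using assms by (simp add: diff_divide_distrib[symmetric])
qed (use assms in auto)

definition moment_bounds :: "real \<Rightarrow> real \<Rightarrow> real measure \<Rightarrow> bool" where
  "moment_bounds \<mu> \<psi> P \<longleftrightarrow> real_distribution P \<and>
     integrable P (\<lambda>x. x) \<and> (\<integral>x. x \<partial>P) = \<mu> \<and> \<mu> \<in> {0..1} \<and>
     integrable P (\<lambda>x. (x - \<mu>)^2) \<and> (\<integral>x. (x - \<mu>)^2 \<partial>P) \<le> 1 \<and>
     integrable P (\<lambda>x. (x - \<mu>)^4) \<and> (\<integral>x. (x - \<mu>)^4 \<partial>P) \<le> \<psi>^4"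

lemma moment_boundsD:
  assumes "moment_bounds \<mu> \<psi> P"
  shows "prob_space P" "sets P = sets borel" "integrable P (\<lambda>x. x\<^sup>2)" "(\<integral>x. x\<^sup>2 \<partial>P) \<le> 2"
    "integrable P (\<lambda>x. (clip T x)\<^sup>2)" "integrable P (\<lambda>x. (x - clip T x)\<^sup>2)"
proof -
  interpret real_distribution P using assms by (simp add: moment_bounds_def)
  show "prob_space P" "sets P = sets borel" by (rule prob_space_axioms, simp)
  have b: "integrable P (\<lambda>x. x)" "(\<integral>x. x \<partial>P) = \<mu>" "\<mu> \<in> {0..1}"
     "integrable P (\<lambda>x. (x - \<mu>)^2)" "(\<integral>x. (x - \<mu>)^2 \<partial>P) \<le> 1"
    using assms by (auto simp: moment_bounds_def)
  have "integrable P (\<lambda>x. (x - \<mu>)\<^sup>2 + 2 * \<mu> * x - \<mu>\<^sup>2)"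
    using b by auto
  moreover have "(\<lambda>x. (x - \<mu>)\<^sup>2 + 2 * \<mu> * x - \<mu>\<^sup>2) = (\<lambda>x. x\<^sup>2)"
    by (simp add: power2_eq_square algebra_simps)
  ultimately show i: "integrable P (\<lambda>x. x\<^sup>2)" by simp
  have "(\<integral>x. x\<^sup>2 \<partial>P) = (\<integral>x. (x - \<mu>)\<^sup>2 \<partial>P) + \<mu>\<^sup>2"
    using variance_eq[of "\<lambda>x. x"] b i by simp
  moreover have "\<mu>\<^sup>2 \<le> 1" using b by (simp add: power_le_one)
  ultimately show "(\<integral>x. x\<^sup>2 \<partial>P) \<le> 2" using b by simp
  show c: "integrable P (\<lambda>x. (clip T x)\<^sup>2)"
  proof (rule integrable_const_bound)
    show "AE x in P. norm ((clip T x)\<^sup>2) \<le> T\<^sup>2"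
      using abs_clip_le[of T] by (auto simp: abs_le_square_iff)
  qed simp
  have "integrable P (\<lambda>x. 2 * x\<^sup>2 + 2 * (clip T x)\<^sup>2)"
    using i c by simp
  then show "integrable P (\<lambda>x. (x - clip T x)\<^sup>2)"
  proof (rule Bochner_Integration.integrable_bound)
    have "(x - clip T x)\<^sup>2 \<le> 2 * x\<^sup>2 + 2 * (clip T x)\<^sup>2" for x
      using zero_le_power2[of "x + clip T x"] by (simp add: power2_eq_square algebra_simps)
    then have "norm ((x - clip T x)\<^sup>2) \<le> norm (2 * x\<^sup>2 + 2 * (clip T x)\<^sup>2)" for x
      by (metis abs_of_nonneg order_trans real_norm_def zero_le_power2)
    then show "AE x in P. norm ((x - clip T x)\<^sup>2) \<le> norm (2 * x\<^sup>2 + 2 * (clip T x)\<^sup>2)"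
      by (rule AE_I2)
  qed simp
qed

lemma clipped_mean_unbiased:
  assumes P: "moment_bounds \<mu> \<psi> P" and n: "n \<ge> 1" and p: "0 < p" "p \<le> 1"
  shows "mean_variance (output_law n P (clipped_mean n \<epsilon> T p)) (\<lambda>y. y) \<mu>
    ((\<integral>x. (x - \<mu>)\<^sup>2 \<partial>P) / n + (1 - p) / (n * p) * (\<integral>x. (x - clip T x)\<^sup>2 \<partial>P)
      + 2 * (2 * T / (n * \<epsilon>))\<^sup>2)"
proof -
  interpret real_distribution P using P by (simp add: moment_bounds_def)
  have eq: "clip T x / n + p * ((x - clip T x) / (n * p)) = 1 / n * x" for x
    using n p by (simp add: field_simps)
  have "mean_variance P (\<lambda>x. 1 / n * x) (1 / n * (\<integral>x. x \<partial>P)) ((1 / n)\<^sup>2 * variance (\<lambda>x. x))"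
    using moment_boundsD[OF P] by (intro mean_variance_scaleI) auto
  then have u: "mean_variance P (\<lambda>x. clip T x / n + p * ((x - clip T x) / (n * p)))
      (1 / n * \<mu>) ((1 / n)\<^sup>2 * (\<integral>x. (x - \<mu>)\<^sup>2 \<partial>P))"
    using P unfolding eq by (simp add: moment_bounds_def)
  have h: "integrable P (\<lambda>x. ((x - clip T x) / (n * p))\<^sup>2)"
    using moment_boundsD(6)[OF P, of T] by (simp add: power_divide)
  have "mean_variance (output_law n P (clipped_mean n \<epsilon> T p)) (\<lambda>y. y) (n * (1 / n * \<mu>))
     (n * ((1 / n)\<^sup>2 * (\<integral>x. (x - \<mu>)\<^sup>2 \<partial>P))
       + n * (p * (1 - p) * (\<integral>x. ((x - clip T x) / (n * p))\<^sup>2 \<partial>P)) + 2 * (2 * T / (n * \<epsilon>))\<^sup>2)"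
    unfolding clipped_mean_def using moment_boundsD(1,2)[OF P] p
    by (intro mean_variance_output_law_sampled_sum u h) auto
  moreover have "n * ((1 / n)\<^sup>2 * (\<integral>x. (x - \<mu>)\<^sup>2 \<partial>P)) = (\<integral>x. (x - \<mu>)\<^sup>2 \<partial>P) / n"
    using n by (simp add: power2_eq_square)
  moreover have "n * (p * (1 - p) * (\<integral>x. ((x - clip T x) / (n * p))\<^sup>2 \<partial>P)) =
      (1 - p) / (n * p) * (\<integral>x. (x - clip T x)\<^sup>2 \<partial>P)"
    using n p by (simp add: power_divide) (simp add: power2_eq_square)
  ultimately show ?thesis using n by simp
qed

lemma clipped_mean_biased:
  assumes P: "moment_bounds \<mu> \<psi> P" and n: "n \<ge> 1"
  shows "mean_variance (output_law n P (clipped_mean n \<epsilon> T 0)) (\<lambda>y. y) (\<integral>x. clip T x \<partial>P)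
    ((\<integral>x. (clip T x - (\<integral>x. clip T x \<partial>P))\<^sup>2 \<partial>P) / n + 2 * (2 * T / (n * \<epsilon>))\<^sup>2)"
proof -
  interpret real_distribution P using P by (simp add: moment_bounds_def)
  have eq: "clip T x / n + 0 * ((x - clip T x) / (real n * 0)) = 1 / n * clip T x" for x
    by simp
  have u: "mean_variance P (\<lambda>x. clip T x / n + 0 * ((x - clip T x) / (real n * 0)))
      (1 / n * (\<integral>x. clip T x \<partial>P)) ((1 / n)\<^sup>2 * variance (clip T))"
    unfolding eq by (rule mean_variance_scaleI[OF _ moment_boundsD(5)[OF P]]) simp
  have "mean_variance (output_law n P (clipped_mean n \<epsilon> T 0)) (\<lambda>y. y) (n * (1 / n * (\<integral>x. clip T x \<partial>P)))
     (n * ((1 / n)\<^sup>2 * variance (clip T))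
       + n * (0 * (1 - 0) * (\<integral>x. ((x - clip T x) / (real n * 0))\<^sup>2 \<partial>P)) + 2 * (2 * T / (n * \<epsilon>))\<^sup>2)"
    unfolding clipped_mean_def using moment_boundsD(1,2)[OF P]
    by (intro mean_variance_output_law_sampled_sum u) simp_all
  moreover have "n * (1 / n * (\<integral>x. clip T x \<partial>P)) = (\<integral>x. clip T x \<partial>P)"
    "n * ((1 / n)\<^sup>2 * variance (clip T)) = variance (clip T) / n"
    using n by (simp_all add: power2_eq_square)
  ultimately show ?thesis by simp
qed

lemma prob_space_output_law:
  assumes M: "randomized_algorithm n borel borel M" and P: "real_distribution P"
  shows "prob_space (output_law n P M)"
proof -
  interpret real_distribution P by fact
  have "sets (PiM {..<n} (\<lambda>_. P)) = sets (PiM {..<n} (\<lambda>_. borel))"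
    by (intro sets_PiM_cong) auto
  then have K: "M \<in> PiM {..<n} (\<lambda>_. P) \<rightarrow>\<^sub>M prob_algebra borel"
    using M by (simp add: randomized_algorithm_def cong: measurable_cong_sets)
  have "prob_space (PiM {..<n} (\<lambda>_. P))"
    by (intro prob_space_PiM) unfold_locales
  then show ?thesis
    unfolding output_law_def using K by (auto intro!: prob_space_bind' simp: space_prob_algebra)
qed

text \<open>
  Accuracy is stated by \<open>mean_variance\<close>, which also carries the integrability of the output. The bound
  \<open>e\<close> is on the mean squared error, which is the variance plus the square of the bias.
\<close>

definition accurate :: "nat \<Rightarrow> real \<Rightarrow> real \<Rightarrow> real \<Rightarrow> ((nat \<Rightarrow> real) \<Rightarrow> real measure) \<Rightarrow> bool" where
  "accurate n \<psi> \<beta> e M \<longleftrightarrow> (\<forall>P \<mu>. moment_bounds \<mu> \<psi> P \<longrightarrow>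
     (\<exists>m v. mean_variance (output_law n P M) (\<lambda>y. y) m v \<and> \<bar>m - \<mu>\<bar> \<le> \<beta> \<and> v + (m - \<mu>)\<^sup>2 \<le> e))"

lemma accurate_mono: "accurate n \<psi> \<beta> e M \<Longrightarrow> e \<le> e' \<Longrightarrow> accurate n \<psi> \<beta> e' M"
  unfolding accurate_def by (meson order_trans)

text \<open>
  Up to sign, the bias is the mean of the residual, which is at most \<open>E[X^2] / T \<le> 2 / T\<close>; this fixes
  \<open>T = 2 / \<beta>\<close>. Clipping is a contraction and therefore does not increase the variance.
\<close>

lemma accurate_biased:
  assumes n: "n \<ge> 1" and \<beta>: "0 < \<beta>"
  shows "accurate n \<psi> \<beta> (1 / n + \<beta>\<^sup>2 + 32 / ((real n)\<^sup>2 * \<epsilon>\<^sup>2 * \<beta>\<^sup>2)) (clipped_mean n \<epsilon> (2 / \<beta>) 0)"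
  unfolding accurate_def
proof (intro allI impI exI conjI)
  fix P \<mu> assume P: "moment_bounds \<mu> \<psi> P"
  interpret real_distribution P using P by (simp add: moment_bounds_def)
  let ?T = "2 / \<beta>"
  let ?m = "\<integral>x. clip ?T x \<partial>P"
  note [simp] = moment_boundsD(3,5,6)[OF P]
  have id: "integrable P (\<lambda>x. x)" "(\<integral>x. x \<partial>P) = \<mu>"
    using P by (auto simp: moment_bounds_def)
  have ci: "integrable P (clip ?T)"
    by (rule square_integrable_imp_integrable) auto
  show "mean_variance (output_law n P (clipped_mean n \<epsilon> ?T 0)) (\<lambda>y. y) ?m
    ((\<integral>x. (clip ?T x - ?m)\<^sup>2 \<partial>P) / n + 2 * (2 * ?T / (n * \<epsilon>))\<^sup>2)"
    by (rule clipped_mean_biased[OF P n])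
  have "\<bar>?m - \<mu>\<bar> = \<bar>\<integral>x. x - clip ?T x \<partial>P\<bar>"
    using id ci by simp
  also have "\<dots> \<le> (\<integral>x. \<bar>x - clip ?T x\<bar> \<partial>P)"
    by (rule integral_abs_bound)
  also have "\<dots> \<le> (\<integral>x. x\<^sup>2 / ?T \<partial>P)"
    using clip_residual_le[of ?T] \<beta> id ci by (intro integral_mono) auto
  also have "\<dots> \<le> 2 / ?T"
    using moment_boundsD(4)[OF P] \<beta> by (simp add: field_simps)
  finally show b: "\<bar>?m - \<mu>\<bar> \<le> \<beta>" using \<beta> by simp
  then have "(?m - \<mu>)\<^sup>2 \<le> \<beta>\<^sup>2" using \<beta> by (simp add: abs_le_square_iff[symmetric])
  moreover have "(\<integral>x. (clip ?T x - ?m)\<^sup>2 \<partial>P) \<le> 1"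
  proof -
    have mv: "mean_variance P (clip ?T) ?m (\<integral>x. (clip ?T x - ?m)\<^sup>2 \<partial>P)"
      by (intro mean_varianceI) auto
    \<comment> \<open>The mean minimises the second moment; comparing with the point \<open>clip ?T \<mu>\<close> makes the contraction applicable.\<close>
    have "(\<integral>x. (clip ?T x - ?m)\<^sup>2 \<partial>P) \<le> (\<integral>x. (clip ?T x - clip ?T \<mu>)\<^sup>2 \<partial>P)"
      using mean_varianceD(4)[OF mv, of "clip ?T \<mu>"] by simp
    also have "\<dots> \<le> (\<integral>x. (x - \<mu>)\<^sup>2 \<partial>P)"
      using P clip_contraction mean_varianceD(3)[OF mv]
      by (intro integral_mono) (auto simp: moment_bounds_def abs_le_square_iff[symmetric])
    also have "\<dots> \<le> 1" using P by (simp add: moment_bounds_def)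
    finally show ?thesis .
  qed
  then have "(\<integral>x. (clip ?T x - ?m)\<^sup>2 \<partial>P) / n \<le> 1 / n"
    by (intro divide_right_mono) auto
  moreover have "2 * (2 * ?T / (n * \<epsilon>))\<^sup>2 = 32 / ((real n)\<^sup>2 * \<epsilon>\<^sup>2 * \<beta>\<^sup>2)"
    by (simp add: power_divide power_mult_distrib)
  ultimately show "(\<integral>x. (clip ?T x - ?m)\<^sup>2 \<partial>P) / n + 2 * (2 * ?T / (n * \<epsilon>))\<^sup>2 + (?m - \<mu>)\<^sup>2
    \<le> 1 / n + \<beta>\<^sup>2 + 32 / ((real n)\<^sup>2 * \<epsilon>\<^sup>2 * \<beta>\<^sup>2)" by simp
qed

lemma accurate_unbiased:
  assumes n: "n \<ge> 1" and p: "0 < p" "p \<le> 1" and \<beta>: "0 \<le> \<beta>"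
    and r: "\<And>P \<mu>. moment_bounds \<mu> \<psi> P \<Longrightarrow> (\<integral>x. (x - clip T x)\<^sup>2 \<partial>P) \<le> r"
  shows "accurate n \<psi> \<beta> (1 / n + (1 - p) / (n * p) * r + 8 * T\<^sup>2 / ((real n)\<^sup>2 * \<epsilon>\<^sup>2)) (clipped_mean n \<epsilon> T p)"
  unfolding accurate_def
proof (intro allI impI exI conjI)
  fix P \<mu> assume P: "moment_bounds \<mu> \<psi> P"
  let ?v = "(\<integral>x. (x - \<mu>)\<^sup>2 \<partial>P) / n + (1 - p) / (n * p) * (\<integral>x. (x - clip T x)\<^sup>2 \<partial>P)
      + 2 * (2 * T / (n * \<epsilon>))\<^sup>2"
  show "mean_variance (output_law n P (clipped_mean n \<epsilon> T p)) (\<lambda>y. y) \<mu> ?v"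
    by (rule clipped_mean_unbiased[OF P n p])
  show "\<bar>\<mu> - \<mu>\<bar> \<le> \<beta>" using \<beta> by simp
  have "(\<integral>x. (x - \<mu>)\<^sup>2 \<partial>P) / n \<le> 1 / n"
    using P by (intro divide_right_mono) (auto simp: moment_bounds_def)
  moreover have "(1 - p) / (n * p) * (\<integral>x. (x - clip T x)\<^sup>2 \<partial>P) \<le> (1 - p) / (n * p) * r"
    using p by (intro mult_left_mono r[OF P]) auto
  moreover have "2 * (2 * T / (n * \<epsilon>))\<^sup>2 = 8 * T\<^sup>2 / ((real n)\<^sup>2 * \<epsilon>\<^sup>2)"
    by (simp add: power_divide power_mult_distrib)
  ultimately show "?v + (\<mu> - \<mu>)\<^sup>2 \<le> 1 / n + (1 - p) / (n * p) * r + 8 * T\<^sup>2 / ((real n)\<^sup>2 * \<epsilon>\<^sup>2)"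
    by simp
qed

lemma accurate_sampled:
  assumes n: "n \<ge> 1" and p: "0 < p" "p \<le> 1" and \<beta>: "0 \<le> \<beta>"
  shows "accurate n \<psi> \<beta> (1 / n + 2 * (1 - p) / (n * p)) (clipped_mean n \<epsilon> 0 p)"
  using accurate_unbiased[OF n p \<beta>, of \<psi> 0 2 \<epsilon>] moment_boundsD(4) by (simp add: mult.commute)

text \<open>
  The sampling error \<open>\<psi>^4 / (n * p * t^2)\<close> and the noise \<open>t^2 / (n^2 * \<epsilon>^2)\<close> are equal for this
  value of \<open>t\<close>; both are then \<open>\<psi>^2 / (n * sqrt n * \<epsilon> * sqrt p)\<close>. The last summand is the noise
  due to the \<open>1\<close> in the clipping radius \<open>1 + t\<close>.
\<close>

lemma accurate_tail_sampled:
  fixes \<psi> :: real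
  assumes n: "n \<ge> 1" and p: "0 < p" "p \<le> 1" and \<beta>: "0 \<le> \<beta>" and \<epsilon>: "0 < \<epsilon>" and \<psi>: "0 < \<psi>"
  defines "t \<equiv> sqrt (\<psi>\<^sup>2 * sqrt n * \<epsilon> / sqrt p)"
  shows "accurate n \<psi> \<beta>
    (1 / n + 17 * (\<psi>\<^sup>2 / (n * sqrt n * \<epsilon> * sqrt p)) + 16 / ((real n)\<^sup>2 * \<epsilon>\<^sup>2)) (clipped_mean n \<epsilon> (1 + t) p)"
proof (rule accurate_mono)
  have t: "0 < t" and t2: "t\<^sup>2 = \<psi>\<^sup>2 * sqrt n * \<epsilon> / sqrt p"
    using n p \<epsilon> \<psi> by (auto simp: t_def)
  have r: "(\<integral>x. (x - clip (1 + t) x)\<^sup>2 \<partial>P) \<le> \<psi> ^ 4 / t\<^sup>2" if P: "moment_bounds \<mu> \<psi> P" for P \<mu>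
  proof -
    have b: "\<bar>\<mu>\<bar> \<le> 1" "integrable P (\<lambda>x. (x - \<mu>)^4)" "(\<integral>x. (x - \<mu>)^4 \<partial>P) \<le> \<psi>^4"
      using P by (auto simp: moment_bounds_def)
    have "(\<integral>x. (x - clip (1 + t) x)\<^sup>2 \<partial>P) \<le> (\<integral>x. (x - \<mu>) ^ 4 / t\<^sup>2 \<partial>P)"
      using b t moment_boundsD(6)[OF P] by (intro integral_mono clip_residual_square_le) auto
    also have "\<dots> \<le> \<psi> ^ 4 / t\<^sup>2"
      using b by (auto intro!: divide_right_mono)
    finally show ?thesis .
  qed
  show "accurate n \<psi> \<beta> (1 / n + (1 - p) / (n * p) * (\<psi> ^ 4 / t\<^sup>2) + 8 * (1 + t)\<^sup>2 / ((real n)\<^sup>2 * \<epsilon>\<^sup>2))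
    (clipped_mean n \<epsilon> (1 + t) p)"
    by (intro accurate_unbiased n p \<beta> r)
  define a where "a = \<psi>\<^sup>2 / (n * sqrt n * \<epsilon> * sqrt p)"
  have "(1 - p) / (n * p) * (\<psi> ^ 4 / t\<^sup>2) \<le> 1 / (n * p) * (\<psi> ^ 4 / t\<^sup>2)"
    using n p by (intro mult_right_mono divide_right_mono) auto
  also have "\<dots> = a"
  proof -
    have "1 / (N * q\<^sup>2) * (y ^ 4 / (y\<^sup>2 * w * e / q)) = y\<^sup>2 / (N * w * e * q)"
      if "0 < N" "0 < q" "0 < y" "0 < w" "0 < e" for N q y w e :: real
      using that by (simp add: field_simps eval_nat_numeral)
    from this[of n "sqrt p" \<psi> "sqrt n" \<epsilon>] show ?thesis
      using n p \<psi> \<epsilon> by (simp add: a_def t2)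
  qed
  finally have 1: "(1 - p) / (n * p) * (\<psi> ^ 4 / t\<^sup>2) \<le> a" .
  have "(1 + t)\<^sup>2 \<le> 2 + 2 * t\<^sup>2"
    using zero_le_power2[of "1 - t"] by (simp add: power2_eq_square algebra_simps)
  then have "8 * (1 + t)\<^sup>2 / ((real n)\<^sup>2 * \<epsilon>\<^sup>2) \<le> (16 + 16 * t\<^sup>2) / ((real n)\<^sup>2 * \<epsilon>\<^sup>2)"
    by (intro divide_right_mono) auto
  also have "\<dots> = 16 / ((real n)\<^sup>2 * \<epsilon>\<^sup>2) + 16 * (t\<^sup>2 / ((real n)\<^sup>2 * \<epsilon>\<^sup>2))"
    by (simp add: add_divide_distrib)
  also have "t\<^sup>2 / ((real n)\<^sup>2 * \<epsilon>\<^sup>2) = a"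
  proof -
    have "(y\<^sup>2 * w * e / q) / ((w * w)\<^sup>2 * e\<^sup>2) = y\<^sup>2 / (w * w * w * e * q)"
      if "0 < q" "0 < w" "0 < e" for q y w e :: real
      using that by (simp add: field_simps eval_nat_numeral)
    from this[of "sqrt p" "sqrt n" \<epsilon> \<psi>] show ?thesis
      using n p \<epsilon> by (simp add: a_def t2)
  qed
  finally show "1 / n + (1 - p) / (n * p) * (\<psi> ^ 4 / t\<^sup>2) + 8 * (1 + t)\<^sup>2 / ((real n)\<^sup>2 * \<epsilon>\<^sup>2)
    \<le> 1 / n + 17 * (\<psi>\<^sup>2 / (n * sqrt n * \<epsilon> * sqrt p)) + 16 / ((real n)\<^sup>2 * \<epsilon>\<^sup>2)"
    using 1 unfolding a_def[symmetric] by linarith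
qed

section \<open>Choice of the parameters\<close>

lemma exists_private_accurate:
  assumes pos: "0 < \<epsilon>" "0 < \<delta>" "0 < \<beta>" "0 < \<psi>" and n: "n \<ge> 1"
  shows "\<exists>M. differentially_private n borel borel \<epsilon> \<delta> M \<and>
    accurate n \<psi> \<beta> (32 * (1 / real n +
      min (1 / ((real n)^2 * \<epsilon>^2 * \<beta>^2) + \<beta>^2)
        (min (\<psi>^2 / (real n powr (3/2) * \<epsilon> * \<delta> powr (1/2)) + 1 / ((real n)^2 * \<epsilon>^2))
             (1 / (real n * \<delta>))))) M"
    (is "\<exists>M. ?dp M \<and> accurate n \<psi> \<beta> (32 * (1 / real n + min ?B1 (min ?B2 ?B3))) M")
proof -
  have min_cases: "min a (min b c) = a \<or> min a (min b c) = b \<or> min a (min b c) = c"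
    for a b c :: real by (simp add: min_def)
  have B: "0 \<le> ?B1" "0 \<le> ?B2" "0 \<le> ?B3" using pos by auto
  have *: "\<exists>M. ?dp M \<and> accurate n \<psi> \<beta> (32 * (1 / real n + b)) M"
    if "0 \<le> T" "0 \<le> p" "p \<le> 1" "p \<le> \<delta>" "accurate n \<psi> \<beta> e (clipped_mean n \<epsilon> T p)"
      "e \<le> 32 * (1 / real n + b)" for T p e b
    using differentially_private_clipped_mean[OF n pos(1) that(1,2,3,4)] accurate_mono[OF that(5,6)]
    by (intro exI conjI)
  consider "1 \<le> \<delta>" | "\<delta> < 1" "min ?B1 (min ?B2 ?B3) = ?B1" | "\<delta> < 1" "min ?B1 (min ?B2 ?B3) = ?B2"
    | "\<delta> < 1" "min ?B1 (min ?B2 ?B3) = ?B3"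
    using min_cases[of ?B1 ?B2 ?B3] by (metis linorder_not_less)
  then show ?thesis
  proof cases
    case 1
    have "1 / real n \<le> 32 * (1 / real n + min ?B1 (min ?B2 ?B3))"
      using B n by (simp add: min_def field_simps)
    then show ?thesis
      using 1 pos accurate_sampled[OF n, of 1 \<beta> \<psi> \<epsilon>] by (intro *[of 0 1]) auto
  next
    case 2
    show ?thesis unfolding 2(2)
    proof (rule *[of "2 / \<beta>" 0])
      show "accurate n \<psi> \<beta> (1 / n + \<beta>\<^sup>2 + 32 / ((real n)\<^sup>2 * \<epsilon>\<^sup>2 * \<beta>\<^sup>2)) (clipped_mean n \<epsilon> (2 / \<beta>) 0)"
        using pos by (intro accurate_biased n)
      have "0 \<le> 1 / real n" "0 \<le> \<beta>\<^sup>2" by auto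
      then show "1 / n + \<beta>\<^sup>2 + 32 / ((real n)\<^sup>2 * \<epsilon>\<^sup>2 * \<beta>\<^sup>2) \<le> 32 * (1 / real n + ?B1)"
        unfolding distrib_left by linarith
    qed (use pos in auto)
  next
    case 3
    let ?t = "sqrt (\<psi>\<^sup>2 * sqrt n * \<epsilon> / sqrt \<delta>)"
    have sum_le: "a + 17 * b + 16 * c \<le> 32 * (a + (b + c))" if "0 \<le> b" "0 \<le> c" "0 \<le> a"
      for a b c :: real using that by simp
    have dh: "\<delta> powr (1/2) = sqrt \<delta>"
      using pos by (simp add: powr_half_sqrt)
    have "real n powr (3/2) = real n powr (1 + 1/2)" by simp
    also have "\<dots> = n * sqrt n"
      using n unfolding powr_add by (simp add: powr_half_sqrt)
    finally have pw: "real n powr (3/2) = n * sqrt n" .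
    show ?thesis unfolding 3(2)
    proof (rule *[of "1 + ?t" \<delta>])
      show "accurate n \<psi> \<beta> (1 / n + 17 * (\<psi>\<^sup>2 / (n * sqrt n * \<epsilon> * sqrt \<delta>)) + 16 / ((real n)\<^sup>2 * \<epsilon>\<^sup>2))
        (clipped_mean n \<epsilon> (1 + ?t) \<delta>)"
        using pos 3 by (intro accurate_tail_sampled n) auto
      have "0 \<le> \<psi>\<^sup>2 / (n * sqrt n * \<epsilon> * sqrt \<delta>)" "0 \<le> 1 / ((real n)\<^sup>2 * \<epsilon>\<^sup>2)" "0 \<le> 1 / real n"
        using pos by auto
      then show "1 / n + 17 * (\<psi>\<^sup>2 / (n * sqrt n * \<epsilon> * sqrt \<delta>)) + 16 / ((real n)\<^sup>2 * \<epsilon>\<^sup>2) \<le> 32 * (1 / real n + ?B2)"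
        unfolding pw dh using sum_le[where a = "1 / real n" and
          b = "\<psi>\<^sup>2 / (n * sqrt n * \<epsilon> * sqrt \<delta>)" and c = "1 / ((real n)\<^sup>2 * \<epsilon>\<^sup>2)"] by simp
    qed (use pos 3 in auto)
  next
    case 4
    show ?thesis unfolding 4(2)
    proof (rule *[of 0 \<delta>])
      show "accurate n \<psi> \<beta> (1 / n + 2 * (1 - \<delta>) / (n * \<delta>)) (clipped_mean n \<epsilon> 0 \<delta>)"
        using pos 4 by (intro accurate_sampled n) auto
      have "2 * (1 - \<delta>) / (n * \<delta>) \<le> 32 / (n * \<delta>)"
        using pos by (intro divide_right_mono) auto
      moreover have "32 / (n * \<delta>) = 32 * ?B3" "0 \<le> 1 / real n" by simp_all
      ultimately show "1 / n + 2 * (1 - \<delta>) / (n * \<delta>) \<le> 32 * (1 / real n + ?B3)"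
        unfolding distrib_left by linarith
    qed (use pos 4 in auto)
  qed
qed

theorem theorem1p3:
  "\<exists>C::real. C > 0 \<and>
    (\<forall>(\<epsilon>::real) (\<delta>::real) (\<beta>::real) (\<psi>::real) (n::nat).
       \<epsilon> > 0 \<longrightarrow> \<delta> > 0 \<longrightarrow> \<beta> > 0 \<longrightarrow> \<psi> > 0 \<longrightarrow> n \<ge> 1 \<longrightarrow>
       (\<exists>M :: (nat \<Rightarrow> real) \<Rightarrow> real measure.
          differentially_private n borel borel \<epsilon> \<delta> M \<and>
          (\<forall>(P::real measure) (\<mu>::real).
             real_distribution P \<longrightarrow>
             integrable P (\<lambda>x. x) \<longrightarrow> (\<integral>x. x \<partial>P) = \<mu> \<longrightarrow> \<mu> \<in> {0..1} \<longrightarrow>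
             integrable P (\<lambda>x. (x - \<mu>)^2) \<longrightarrow> (\<integral>x. (x - \<mu>)^2 \<partial>P) \<le> 1 \<longrightarrow>
             integrable P (\<lambda>x. (x - \<mu>)^4) \<longrightarrow> (\<integral>x. (x - \<mu>)^4 \<partial>P) \<le> \<psi>^4 \<longrightarrow>
             integrable (output_law n P M) (\<lambda>y. y - \<mu>) \<and>
             \<bar>\<integral>y. (y - \<mu>) \<partial>(output_law n P M)\<bar> \<le> \<beta> \<and>
             integrable (output_law n P M) (\<lambda>y. (y - \<mu>)^2) \<and>
             (\<integral>y. (y - \<mu>)^2 \<partial>(output_law n P M))
               \<le> C * (1 / real n +
                      min (1 / ((real n)^2 * \<epsilon>^2 * \<beta>^2) + \<beta>^2)
                        (min (\<psi>^2 / (real n powr (3/2) * \<epsilon> * \<delta> powr (1/2))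
                                + 1 / ((real n)^2 * \<epsilon>^2))
                             (1 / (real n * \<delta>)))))))"
proof (rule exI[of _ 32], intro conjI allI impI, goal_cases)
  case 1
  show ?case by simp
next
  case (2 \<epsilon> \<delta> \<beta> \<psi> n)
  from exists_private_accurate[OF 2] obtain M where
    dp: "differentially_private n borel borel \<epsilon> \<delta> M" and acc: "accurate n \<psi> \<beta> (32 * (1 / real n +
      min (1 / ((real n)^2 * \<epsilon>^2 * \<beta>^2) + \<beta>^2)
        (min (\<psi>^2 / (real n powr (3/2) * \<epsilon> * \<delta> powr (1/2)) + 1 / ((real n)^2 * \<epsilon>^2))
             (1 / (real n * \<delta>))))) M" (is "accurate _ _ _ ?e _")
    by blast
  show ?case
  proof (rule exI[of _ M], intro conjI[OF dp] allI impI)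
    fix P :: "real measure" and \<mu> :: real
    assume P: "real_distribution P" "integrable P (\<lambda>x. x)" "(\<integral>x. x \<partial>P) = \<mu>" "\<mu> \<in> {0..1}"
      "integrable P (\<lambda>x. (x - \<mu>)^2)" "(\<integral>x. (x - \<mu>)^2 \<partial>P) \<le> 1"
      "integrable P (\<lambda>x. (x - \<mu>)^4)" "(\<integral>x. (x - \<mu>)^4 \<partial>P) \<le> \<psi>^4"
    then have "moment_bounds \<mu> \<psi> P" by (simp add: moment_bounds_def)
    then obtain m v where mv: "mean_variance (output_law n P M) (\<lambda>y. y) m v"
      and le: "\<bar>m - \<mu>\<bar> \<le> \<beta>" "v + (m - \<mu>)\<^sup>2 \<le> ?e"
      using acc unfolding accurate_def by blast
    interpret prob_space "output_law n P M"
      using dp P by (intro prob_space_output_law) (simp_all add: differentially_private_def)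
    show "integrable (output_law n P M) (\<lambda>y. y - \<mu>) \<and>
       \<bar>\<integral>y. (y - \<mu>) \<partial>(output_law n P M)\<bar> \<le> \<beta> \<and>
       integrable (output_law n P M) (\<lambda>y. (y - \<mu>)^2) \<and>
       (\<integral>y. (y - \<mu>)^2 \<partial>(output_law n P M)) \<le> ?e"
      using mean_varianceD[OF mv] le by (simp add: prob_space)
  qed
qed

end
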